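(* Let $k$ be an integer with $k \ge 2$. Then $G$ is a cograph minimal $(\infty,k)$-polar obstruction of type $(k+2,k+1)$ if and only if $G \cong (k+1)K_1 + H$, where $H$ is isomorphic to $K_{k+1,k+1}$ or to $K_1 \oplus C_4$.
   Context: All graphs are finite and simple. A cograph is a graph with no induced subgraph isomorphic to $P_4$. $G+H$ denotes disjoint union, $G \oplus H$ the join (disjoint union plus all edges between $G$ and $H$), $nG$ the disjoint union of $n$ copies of $G$; $C_4$ is the 4-cycle and $K_{p,q}$ the complete bipartite graph. A component is trivial if it is isomorphic to $K_1$. A cluster is a disjoint union of complete graphs. For $s,k \in \mathbb{Z}_{\ge 0}\cup\{\infty\}$, an $(s,k)$-polar partition of $G$ is a partition $(A,B)$ of $V(G)$ (parts may be empty) such that $G[A]$ is a complete multipartite graph with at most $s$ parts and $G[B]$ is a cluster with at most $k$ components; $\infty$ means unbounded. $G$ is $(s,k)$-polar if it has such a partition. A cograph minimal $(s,k)$-polar obstruction is a cograph that is not $(s,k)$-polar but all of whose proper induced subgraphs are $(s,k)$-polar. Such an obstruction has type $(c,i)$ if it has exactly $c$ connected components, exactly $i$ of which are trivial. *)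

theory Defs
  imports
    "Graph_Theory.Graph_Theory"
    "HOL-Library.Extended_Nat"
    "HOL-Library.Disjoint_Sets"
begin

text \<open>
  Finite simple graphs are the symmetric digraphs of the locale \<open>graph\<close>: every edge is
  represented by its two opposite arcs, there are no loops and no parallel arcs.
\<close>

subsection \<open>Concrete graphs and graph operations\<close>

definition complete_graph :: "nat \<Rightarrow> nat pair_pre_digraph" where
  "complete_graph n = \<lparr> pverts = {..<n}, parcs = {(i, j). i < n \<and> j < n \<and> i \<noteq> j} \<rparr>"

definition path_graph :: "nat \<Rightarrow> nat pair_pre_digraph" where
  "path_graph n =
     \<lparr> pverts = {..<n}, parcs = {(i, j). i < n \<and> j < n \<and> (j = Suc i \<or> i = Suc j)} \<rparr>"

text \<open>Meaningful only for \<open>n \<ge> 3\<close>.\<close>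

definition cycle_graph :: "nat \<Rightarrow> nat pair_pre_digraph" where
  "cycle_graph n =
     \<lparr> pverts = {..<n},
       parcs = {(i, j). i < n \<and> j < n \<and> (j = Suc i mod n \<or> i = Suc j mod n)} \<rparr>"

definition disjoint_union ::
    "'a pair_pre_digraph \<Rightarrow> 'b pair_pre_digraph \<Rightarrow> ('a + 'b) pair_pre_digraph" where
  "disjoint_union G H =
     \<lparr> pverts = pverts G <+> pverts H,
       parcs = map_prod Inl Inl ` parcs G \<union> map_prod Inr Inr ` parcs H \<rparr>"

definition graph_join ::
    "'a pair_pre_digraph \<Rightarrow> 'b pair_pre_digraph \<Rightarrow> ('a + 'b) pair_pre_digraph" where
  "graph_join G H =
     \<lparr> pverts = pverts (disjoint_union G H),
       parcs = parcs (disjoint_union G H)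
         \<union> (Inl ` pverts G) \<times> (Inr ` pverts H) \<union> (Inr ` pverts H) \<times> (Inl ` pverts G) \<rparr>"

definition copies :: "nat \<Rightarrow> 'a pair_pre_digraph \<Rightarrow> (nat \<times> 'a) pair_pre_digraph" where
  "copies n G =
     \<lparr> pverts = {..<n} \<times> pverts G,
       parcs = {((i, u), (j, v)). i = j \<and> i < n \<and> (u, v) \<in> parcs G} \<rparr>"

subsection \<open>Components, cographs, clusters and complete multipartite graphs\<close>

definition components :: "('a, 'b) pre_digraph \<Rightarrow> ('a, 'b) pre_digraph set" where
  "components G = {C. pre_digraph.max_subgraph G connected C}"

definition trivial_components :: "('a, 'b) pre_digraph \<Rightarrow> ('a, 'b) pre_digraph set" where
  "trivial_components G = {C \<in> components G. digraph_iso C (complete_graph 1)}"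

definition cograph :: "('a, 'b) pre_digraph \<Rightarrow> bool" where
  "cograph G \<longleftrightarrow> graph G \<and> \<not> (\<exists>H. induced_subgraph H G \<and> digraph_iso H (path_graph 4))"

definition cluster :: "('a, 'b) pre_digraph \<Rightarrow> bool" where
  "cluster G \<longleftrightarrow> graph G \<and>
     (\<exists>P. partition_on (verts G) P \<and>
          arcs_ends G = {(u, v). u \<noteq> v \<and> (\<exists>X\<in>P. u \<in> X \<and> v \<in> X)})"

text \<open>
  \<open>P\<close> is the set of (nonempty) parts. The null graph has no part, and an edgeless nonempty
  graph has exactly one.
\<close>

definition complete_multipartite_with_parts :: "('a, 'b) pre_digraph \<Rightarrow> 'a set set \<Rightarrow> bool" where
  "complete_multipartite_with_parts G P \<longleftrightarrow> graph G \<and> partition_on (verts G) P \<and>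
     arcs_ends G = {(u, v). \<exists>X\<in>P. \<exists>Y\<in>P. X \<noteq> Y \<and> u \<in> X \<and> v \<in> Y}"

subsection \<open>Polar partitions and minimal obstructions\<close>

definition polar_partition ::
    "enat \<Rightarrow> enat \<Rightarrow> ('a, 'b) pre_digraph \<Rightarrow> 'a set \<Rightarrow> 'a set \<Rightarrow> bool" where
  "polar_partition s k G A B \<longleftrightarrow>
     A \<union> B = verts G \<and> A \<inter> B = {} \<and>
     (\<exists>P. complete_multipartite_with_parts (G \<restriction> A) P \<and> enat (card P) \<le> s) \<and>
     cluster (G \<restriction> B) \<and> enat (card (components (G \<restriction> B))) \<le> k"

definition polar :: "enat \<Rightarrow> enat \<Rightarrow> ('a, 'b) pre_digraph \<Rightarrow> bool" where
  "polar s k G \<longleftrightarrow> (\<exists>A B. polar_partition s k G A B)"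

definition cograph_minimal_polar_obstruction ::
    "enat \<Rightarrow> enat \<Rightarrow> ('a, 'b) pre_digraph \<Rightarrow> bool" where
  "cograph_minimal_polar_obstruction s k G \<longleftrightarrow>
     cograph G \<and> \<not> polar s k G \<and>
     (\<forall>H. induced_subgraph H G \<and> H \<noteq> G \<longrightarrow> polar s k H)"

definition has_type :: "('a, 'b) pre_digraph \<Rightarrow> nat \<Rightarrow> nat \<Rightarrow> bool" where
  "has_type G c i \<longleftrightarrow> card (components G) = c \<and> card (trivial_components G) = i"

end

theory Submission
  imports Defs
begin

text \<open>
  Let \<open>I\<close> be the set of the \<open>k + 1\<close> isolated vertices and \<open>W\<close> the rest. In a polar partition
  \<open>(A, B)\<close> the cluster \<open>B\<close> cannot contain all of \<open>I\<close>, so \<open>A\<close> meets \<open>I\<close> and is therefore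
  independent. After deleting one isolated vertex the remaining \<open>k\<close> may instead fill up all of
  \<open>B\<close>, and this is the only new possibility; hence in a minimal obstruction \<open>W\<close> is complete
  multipartite. Since \<open>W\<close> does not split into an independent set and a clique, it has two
  parts with at least two vertices. If there is a third part, \<open>W\<close> contains \<open>K\<^sub>1 \<oplus> C\<^sub>4\<close>;
  otherwise both parts have more than \<open>k\<close> vertices and \<open>W\<close> contains \<open>K\<^bsub>k+1,k+1\<^esub>\<close>. Together with
  \<open>I\<close> either graph is already not polar, so by minimality it is all of \<open>W\<close>.
\<close>

section \<open>Polar partitions expressed through the adjacency relation alone\<close>

definition nonadj_trans :: "'a rel \<Rightarrow> 'a set \<Rightarrow> bool" where
  "nonadj_trans E A \<longleftrightarrow>
     (\<forall>x\<in>A. \<forall>y\<in>A. \<forall>z\<in>A. (x, y) \<notin> E \<longrightarrow> (y, z) \<notin> E \<longrightarrow> (x, z) \<notin> E)"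

text \<open>No induced path on three vertices: for symmetric irreflexive \<open>E\<close>, equality
  or adjacency is then an equivalence on \<open>B\<close>. Without \<open>x \<noteq> z\<close>,
  going along an edge and back would force a loop.\<close>

definition adj_trans :: "'a rel \<Rightarrow> 'a set \<Rightarrow> bool" where
  "adj_trans E B \<longleftrightarrow>
     (\<forall>x\<in>B. \<forall>y\<in>B. \<forall>z\<in>B. (x, y) \<in> E \<longrightarrow> (y, z) \<in> E \<longrightarrow> x \<noteq> z \<longrightarrow> (x, z) \<in> E)"

definition independent_set :: "'a rel \<Rightarrow> 'a set \<Rightarrow> bool" where
  "independent_set E J \<longleftrightarrow> (\<forall>x\<in>J. \<forall>y\<in>J. (x, y) \<notin> E)"

text \<open>
  \<open>A\<close> induces a complete multipartite graph iff non-adjacency is transitive on it, and the number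
  of components of a cluster is the size of its largest independent set.
\<close>

definition polar_set :: "nat \<Rightarrow> 'a rel \<Rightarrow> 'a set \<Rightarrow> bool" where
  "polar_set k E X \<longleftrightarrow>
     (\<exists>A B. A \<union> B = X \<and> A \<inter> B = {} \<and> nonadj_trans E A \<and> adj_trans E B \<and>
        (\<forall>J\<subseteq>B. independent_set E J \<longrightarrow> card J \<le> k))"

lemma nonadj_trans_Restr: "nonadj_trans (E \<inter> A \<times> A) A \<longleftrightarrow> nonadj_trans E A"
  by (auto simp: nonadj_trans_def)

lemma adj_trans_Restr: "adj_trans (E \<inter> A \<times> A) A \<longleftrightarrow> adj_trans E A"
  by (auto simp: adj_trans_def)

lemma independent_set_Restr: "J \<subseteq> A \<Longrightarrow> independent_set (E \<inter> A \<times> A) J \<longleftrightarrow> independent_set E J"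
  by (auto simp: independent_set_def)

lemma arcs_ends_induce_subgraph: "arcs_ends (G \<restriction> X) = arcs_ends G \<inter> X \<times> X"
  by (auto simp: arcs_ends_conv)

lemma induce_subgraph_induce_subgraph: "A \<subseteq> X \<Longrightarrow> (G \<restriction> X) \<restriction> A = G \<restriction> A"
  by (intro pre_digraph.equality) auto

lemma (in wf_digraph) induce_subgraph_verts_eq: "G \<restriction> verts G = G"
  by (intro pre_digraph.equality) auto

lemma (in graph) graph_induce_subgraph:
  assumes "X \<subseteq> verts G"
  shows "graph (G \<restriction> X)"
proof -
  have "induced_subgraph (G \<restriction> X) G"
    using assms by (rule induced_induce)
  then show ?thesis
    using digraphI_induced induced_graph_imp_symmetric[OF sym_arcs] digraph.graphI by blast
qed

lemma (in graph) irrefl_arcs_ends: "(x, x) \<notin> arcs_ends G"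
  using adj_not_same by blast

subsection \<open>Components\<close>

text \<open>Connectedness is defined through the symmetric closure of the arcs; \<open>G\<close> is
  symmetric already, so a path in the closure for \<open>C\<close> is a path in
  \<open>G\<close>.\<close>

lemma (in graph) connected_subgraph_reachable:
  assumes "subgraph C G" "connected C" "u \<in> verts C" "v \<in> verts C"
  shows "u \<rightarrow>\<^sup>* v"
proof -
  have "(u, v) \<in> rtrancl_on (verts C) ((arcs_ends C)\<^sup>s)"
    using assms by (auto simp: connected_conv)
  moreover have "(arcs_ends C)\<^sup>s \<subseteq> arcs_ends G"
    using arcs_ends_mono[OF assms(1)] graph_symmetric by (auto simp: symcl_def)
  moreover have "verts C \<subseteq> verts G"
    using assms(1) by auto
  ultimately show ?thesis
    unfolding reachable_def by (metis rtrancl_on_mono)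
qed

text \<open>Paths starting at \<open>u\<close> stay inside the class and can be reversed, so any two
  members are joined through \<open>u\<close>.\<close>

lemma (in graph) connected_reachable_class:
  assumes "u \<in> verts G"
  shows "connected (G \<restriction> {v. u \<rightarrow>\<^sup>* v})"
proof -
  let ?C = "G \<restriction> {v. u \<rightarrow>\<^sup>* v}"
  have "graph ?C"
    by (rule graph_induce_subgraph) (auto dest: reachable_in_verts)
  then interpret C: graph ?C .
  have *: "u \<rightarrow>\<^sup>*\<^bsub>?C\<^esub> v" if "u \<rightarrow>\<^sup>* v" for v
    using that by (rule induce_reachable_preserves_paths)
  show ?thesis
  proof (rule C.connectedI)
    show "verts ?C \<noteq> {}"
      using assms by auto
    fix x y assume "x \<in> verts ?C" "y \<in> verts ?C"
    then have "x \<rightarrow>\<^sup>*\<^bsub>?C\<^esub> y"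
      using * C.symmetric_reachable' C.reachable_trans by (metis induce_subgraph_verts mem_Collect_eq)
    then show "x \<rightarrow>\<^sup>*\<^bsub>mk_symmetric ?C\<^esub> y"
      by (rule C.reachable_mk_symmetricI)
  qed
qed

text \<open>A connected subgraph through \<open>u\<close> lies inside the subgraph induced by the
  reachability class of \<open>u\<close>, which is itself connected. Hence these induced subgraphs
  are exactly the maximal connected ones.\<close>

lemma (in graph) components_eq: "components G = (\<lambda>u. G \<restriction> {v. u \<rightarrow>\<^sup>* v}) ` verts G"
proof -
  let ?c = "\<lambda>u. G \<restriction> {v. u \<rightarrow>\<^sup>* v}"
  have sub: "subgraph (?c u) G" for u
    by (rule subgraph_induce_subgraphI) (auto dest: reachable_in_verts)
  have into: "subgraph C (?c u)" if C: "subgraph C G" "connected C" "u \<in> verts C" for C u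
  proof -
    have *: "verts C \<subseteq> {v. u \<rightarrow>\<^sup>* v}"
      using connected_subgraph_reachable[OF C] by auto
    have "wf_digraph C" "compatible G C" "arcs C \<subseteq> arcs G"
      using C by auto
    then have "arcs C \<subseteq> arcs (?c u)"
      using * wf_digraph.tail_in_verts[OF \<open>wf_digraph C\<close>] wf_digraph.head_in_verts[OF \<open>wf_digraph C\<close>]
      by (auto simp: compatible_def)
    then show ?thesis
      using * \<open>wf_digraph C\<close> \<open>compatible G C\<close>
      by (intro subgraphI) (auto simp: compatible_def)
  qed
  \<comment> \<open>The relation \<open>subgraph\<close> also fixes the tail and head maps, so
    mutual inclusion gives equal records.\<close>
  have anti: "C = D" if "subgraph C D" "subgraph D C" for C D :: "('a, 'b) pre_digraph"
    using that by (intro pre_digraph.equality) (auto simp: subgraph_def compatible_def)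
  show ?thesis
  proof (intro equalityI subsetI)
    fix C assume "C \<in> components G"
    then have C: "subgraph C G" "connected C"
      and max: "\<And>H. H \<noteq> C \<Longrightarrow> subgraph C H \<Longrightarrow> subgraph H G \<Longrightarrow> \<not> connected H"
      by (auto simp: components_def max_subgraph_def)
    from C(2) obtain u where u: "u \<in> verts C"
      by (auto simp: connected_conv)
    then have "u \<in> verts G"
      using C(1) by auto
    then have "?c u = C"
      using max[of "?c u"] into[OF C u] sub connected_reachable_class by blast
    then show "C \<in> ?c ` verts G"
      using \<open>u \<in> verts G\<close> by blast
  next
    fix C assume "C \<in> ?c ` verts G"
    then obtain u where u: "u \<in> verts G" "C = ?c u"
      by auto
    have "H = C" if "subgraph C H" "subgraph H G" "connected H" for H
    proof -
      have "u \<in> verts C"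
        using u by auto
      then have "u \<in> verts H"
        using that(1) by auto
      then show ?thesis
        using into[OF that(2,3)] u that(1) anti by auto
    qed
    then show "C \<in> components G"
      using u sub connected_reachable_class by (auto simp: components_def max_subgraph_def)
  qed
qed

text \<open>An induced subgraph determines its vertex set, so components can be counted as
  reachability classes.\<close>

lemma (in graph) card_components: "card (components G) = card ((\<lambda>u. {v. u \<rightarrow>\<^sup>* v}) ` verts G)"
proof -
  have "components G = induce_subgraph G ` (\<lambda>u. {v. u \<rightarrow>\<^sup>* v}) ` verts G"
    by (simp add: components_eq image_image)
  moreover have "inj_on (induce_subgraph G) S" for S
    by (rule inj_onI) (metis induce_subgraph_verts)
  ultimately show ?thesis
    by (simp add: card_image)
qed

lemma (in graph) reachable_isolated:
  assumes "u \<in> verts G" "\<And>v. (u, v) \<notin> arcs_ends G"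
  shows "{v. u \<rightarrow>\<^sup>* v} = {u}"
  using assms by (auto elim: converse_reachable_cases)

subsection \<open>Isomorphisms\<close>

text \<open>Extracts from an isomorphism, which also maps arcs, its action on vertices and
  adjacency.\<close>

lemma digraph_isoE:
  assumes "digraph_iso G H"
  obtains f where "bij_betw f (verts G) (verts H)"
    "\<And>u v. u \<in> verts G \<Longrightarrow> v \<in> verts G \<Longrightarrow> (u, v) \<in> arcs_ends G \<longleftrightarrow> (f u, f v) \<in> arcs_ends H"
proof -
  from assms obtain h where h: "pre_digraph.digraph_isomorphism G h" "H = app_iso h G"
    unfolding digraph_iso_def by auto
  then interpret wf_digraph G
    by (simp add: pre_digraph.digraph_isomorphism_def)
  have inj: "inj_on (iso_verts h) (verts G)"
    using h(1) by (rule digraph_isomorphism_inj_on_verts)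
  have "(u, v) \<in> arcs_ends G \<longleftrightarrow> (iso_verts h u, iso_verts h v) \<in> arcs_ends H"
    if "u \<in> verts G" "v \<in> verts G" for u v
    using that inj by (auto simp: h(2) arcs_ends_app_iso_eq[OF h(1)] dest: adj_in_verts inj_onD)
  moreover have "bij_betw (iso_verts h) (verts G) (verts H)"
    using inj by (simp add: h(2) bij_betw_def)
  ultimately show thesis
    using that by blast
qed

text \<open>Without parallel arcs, an arc is determined by its ends; a vertex bijection respecting
  adjacency therefore extends to the arcs.\<close>

lemma digraph_isoI:
  assumes "nomulti_digraph G" "nomulti_digraph H"
    and f: "bij_betw f (verts G) (verts H)"
    and adj: "\<And>u v. u \<in> verts G \<Longrightarrow> v \<in> verts G \<Longrightarrow>
      (u, v) \<in> arcs_ends G \<longleftrightarrow> (f u, f v) \<in> arcs_ends H"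
  shows "digraph_iso G H"
proof -
  interpret G: nomulti_digraph G by fact
  interpret H: nomulti_digraph H by fact
  let ?e = "\<lambda>a. (f (tail G a), f (head G a))"
  \<comment> \<open>\<open>g a\<close> is the unique arc of \<open>H\<close> whose ends are the
    images of the ends of \<open>a\<close>.\<close>
  define g where "g a = the_inv_into (arcs H) (arc_to_ends H) (?e a)" for a
  have g: "g a \<in> arcs H" "arc_to_ends H (g a) = ?e a" if "a \<in> arcs G" for a
  proof -
    have "(tail G a, head G a) \<in> arcs_ends G"
      using that by (auto simp: arcs_ends_conv)
    then have "?e a \<in> arc_to_ends H ` arcs H"
      using adj that by (simp add: arcs_ends_def)
    then show "g a \<in> arcs H" "arc_to_ends H (g a) = ?e a"
      unfolding g_def using H.inj_on_arc_to_ends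
      by (auto intro: the_inv_into_into f_the_inv_into_f simp del: arc_to_ends_def)
  qed
  have finj: "inj_on f (verts G)" and fim: "f ` verts G = verts H"
    using f by (auto simp: bij_betw_def)
  have ginj: "inj_on g (arcs G)"
  proof (rule inj_onI)
    fix a b assume ab: "a \<in> arcs G" "b \<in> arcs G" "g a = g b"
    then have "?e a = ?e b"
      using g(2) by metis
    then have "arc_to_ends G a = arc_to_ends G b"
      using ab finj by (auto simp: arc_to_ends_def dest: inj_onD)
    then show "a = b"
      using G.no_multi_arcs ab by blast
  qed
  have gim: "g ` arcs G = arcs H"
  proof (intro equalityI subsetI)
    fix b assume b: "b \<in> arcs H"
    then obtain u v where uv: "u \<in> verts G" "v \<in> verts G" "tail H b = f u" "head H b = f v"
      using fim H.wellformed by (metis imageE)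
    have "(f u, f v) \<in> arcs_ends H"
      using b uv by (auto simp: arcs_ends_conv intro!: image_eqI[of _ _ b])
    then have "(u, v) \<in> arcs_ends G"
      using adj uv by blast
    then obtain a where a: "a \<in> arcs G" "tail G a = u" "head G a = v"
      by auto
    have "g a = b"
      using H.no_multi_arcs[of "g a" b] g[OF a(1)] a b uv by (simp add: arc_to_ends_def)
    then show "b \<in> g ` arcs G"
      using a by blast
  qed (auto intro: g)
  let ?h = "\<lparr> iso_verts = f, iso_arcs = g, iso_head = head H, iso_tail = tail H \<rparr>"
  have "G.digraph_isomorphism ?h"
    using finj ginj g by (auto simp: G.digraph_isomorphism_def G.wf_digraph arc_to_ends_def)
  moreover have "H = app_iso ?h G"
    by (simp add: app_iso_def fim gim)
  ultimately show ?thesis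
    unfolding digraph_iso_def by blast
qed

text \<open>A component is a copy of \<open>K_1\<close> iff its reachability class is a singleton,
  and this happens exactly at vertices without neighbours.\<close>

lemma (in graph) trivial_components_eq:
  "trivial_components G = (\<lambda>u. G \<restriction> {u}) ` {u \<in> verts G. \<forall>v. (u, v) \<notin> arcs_ends G}"
proof -
  have triv: "digraph_iso (G \<restriction> X) (complete_graph 1) \<longleftrightarrow> (\<exists>u. X = {u})" if X: "X \<subseteq> verts G" for X
  proof
    assume "digraph_iso (G \<restriction> X) (complete_graph 1)"
    then obtain f where "bij_betw f X {..<1::nat}"
      by (auto elim!: digraph_isoE simp: complete_graph_def)
    then have "card X = 1"
      by (auto dest: bij_betw_same_card)
    then show "\<exists>u. X = {u}"
      by (rule card_1_singletonE) blast
  next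
    assume "\<exists>u. X = {u}"
    then obtain u where u: "X = {u}" by auto
    have "graph (G \<restriction> X)"
      using X by (rule graph_induce_subgraph)
    then interpret X: graph "G \<restriction> X" .
    show "digraph_iso (G \<restriction> X) (complete_graph 1)"
    proof (rule digraph_isoI)
      show "nomulti_digraph (complete_graph 1)"
        by unfold_locales (auto simp: complete_graph_def)
      show "bij_betw (\<lambda>_. 0) (verts (G \<restriction> X)) (verts (complete_graph 1))"
        by (auto simp: u complete_graph_def bij_betw_def)
    qed (use irrefl_arcs_ends u X.nomulti_digraph in
        \<open>auto simp: complete_graph_def arcs_ends_induce_subgraph\<close>)
  qed
  have iso: "{v. u \<rightarrow>\<^sup>* v} = {w} \<longleftrightarrow> u = w \<and> (\<forall>v. (u, v) \<notin> arcs_ends G)" if "u \<in> verts G" for u w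
  proof
    assume *: "{v. u \<rightarrow>\<^sup>* v} = {w}"
    then have "u = w"
      using that by auto
    then show "u = w \<and> (\<forall>v. (u, v) \<notin> arcs_ends G)"
      using * irrefl_arcs_ends reachable_adjI by (metis mem_Collect_eq singletonD)
  qed (use that reachable_isolated in blast)
  have "trivial_components G = (\<lambda>u. G \<restriction> {v. u \<rightarrow>\<^sup>* v}) ` {u \<in> verts G. \<exists>w. {v. u \<rightarrow>\<^sup>* v} = {w}}"
  proof -
    have "digraph_iso (G \<restriction> {v. u \<rightarrow>\<^sup>* v}) (complete_graph 1) \<longleftrightarrow> (\<exists>w. {v. u \<rightarrow>\<^sup>* v} = {w})" for u
      by (rule triv) (auto dest: reachable_in_verts)
    then show ?thesis
      unfolding trivial_components_def components_eq by blast
  qed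
  also have "\<dots> = (\<lambda>u. G \<restriction> {u}) ` {u \<in> verts G. \<forall>v. (u, v) \<notin> arcs_ends G}"
  proof (rule image_cong)
    fix u assume "u \<in> {u \<in> verts G. \<forall>v. (u, v) \<notin> arcs_ends G}"
    then show "G \<restriction> {v. u \<rightarrow>\<^sup>* v} = G \<restriction> {u}"
      using reachable_isolated by simp
  qed (use iso in blast)
  finally show ?thesis .
qed

lemma (in graph) card_trivial_components:
  "card (trivial_components G) = card {u \<in> verts G. \<forall>v. (u, v) \<notin> arcs_ends G}"
proof -
  have "inj (\<lambda>u. G \<restriction> {u})"
    by (rule injI) (metis induce_subgraph_verts singleton_inject)
  then show ?thesis
    unfolding trivial_components_eq by (auto intro: card_image inj_on_subset)
qed

subsection \<open>Polarity\<close>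

text \<open>Non-adjacency is always reflexive and symmetric on the vertices; once transitive it is
  an equivalence, and its classes are the parts.\<close>

lemma (in graph) complete_multipartite_iff:
  "(\<exists>P. complete_multipartite_with_parts G P) \<longleftrightarrow> nonadj_trans (arcs_ends G) (verts G)"
proof
  assume "\<exists>P. complete_multipartite_with_parts G P"
  then obtain P where P: "partition_on (verts G) P"
    "arcs_ends G = {(u, v). \<exists>X\<in>P. \<exists>Y\<in>P. X \<noteq> Y \<and> u \<in> X \<and> v \<in> Y}"
    by (auto simp: complete_multipartite_with_parts_def)
  have cover: "\<exists>X\<in>P. x \<in> X" if "x \<in> verts G" for x
    using P(1) that by (auto simp: partition_on_def)
  have unique: "X = Y" if "X \<in> P" "Y \<in> P" "x \<in> X" "x \<in> Y" for X Y x
    using P(1) that by (auto simp: partition_on_def disjoint_def)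
  show "nonadj_trans (arcs_ends G) (verts G)"
    unfolding nonadj_trans_def
  proof (intro ballI impI)
    fix x y z assume xyz: "x \<in> verts G" "y \<in> verts G" "z \<in> verts G"
      and non: "(x, y) \<notin> arcs_ends G" "(y, z) \<notin> arcs_ends G"
    from cover xyz obtain X where X: "X \<in> P" "y \<in> X" by blast
    have "x \<in> X"
      using cover[OF xyz(1)] non(1) X by (auto simp: P(2))
    moreover have "z \<in> X"
      using cover[OF xyz(3)] non(2) X by (auto simp: P(2))
    ultimately show "(x, z) \<notin> arcs_ends G"
      using X unique unfolding P(2) by blast
  qed
next
  assume *: "nonadj_trans (arcs_ends G) (verts G)"
  define R where "R = {(u, v). u \<in> verts G \<and> v \<in> verts G \<and> (u, v) \<notin> arcs_ends G}"
  have equiv: "equiv (verts G) R"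
  proof (intro equivI refl_onI symI transI)
    fix x y z assume "(x, y) \<in> R" "(y, z) \<in> R"
    then show "(x, z) \<in> R"
      using * unfolding R_def nonadj_trans_def by blast
  qed (use irrefl_arcs_ends in \<open>auto simp: R_def dest: graph_symmetric\<close>)
  define P where "P = verts G // R"
  have P: "partition_on (verts G) P"
    unfolding P_def using equiv by (rule partition_on_quotient)
  have same: "X = Y \<longleftrightarrow> (x, y) \<in> R" if "X \<in> P" "Y \<in> P" "x \<in> X" "y \<in> Y" for X Y x y
    using that quotient_eq_iff[OF equiv] unfolding P_def by blast
  have "arcs_ends G = {(u, v). \<exists>X\<in>P. \<exists>Y\<in>P. X \<noteq> Y \<and> u \<in> X \<and> v \<in> Y}" (is "_ = ?M")
  proof (intro equalityI subrelI)
    fix u v assume uv: "(u, v) \<in> arcs_ends G"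
    then obtain X Y where "X \<in> P" "u \<in> X" "Y \<in> P" "v \<in> Y"
      using P adj_in_verts by (metis partition_on_def UnionE)
    then show "(u, v) \<in> ?M"
      using same[of X Y u v] uv by (auto simp: R_def)
  next
    fix u v assume "(u, v) \<in> ?M"
    then obtain X Y where XY: "X \<in> P" "Y \<in> P" "X \<noteq> Y" "u \<in> X" "v \<in> Y" by auto
    then have "u \<in> verts G" "v \<in> verts G"
      using P unfolding partition_on_def by blast+
    then show "(u, v) \<in> arcs_ends G"
      using same[of X Y u v] XY by (auto simp: R_def)
  qed
  then show "\<exists>P. complete_multipartite_with_parts G P"
    using P graph_axioms unfolding complete_multipartite_with_parts_def by blast
qed

text \<open>The dual argument: here equality or adjacency is the equivalence, and its classes are
  the cliques.\<close>

lemma (in graph) cluster_iff: "cluster G \<longleftrightarrow> adj_trans (arcs_ends G) (verts G)"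
proof
  assume "cluster G"
  then obtain P where P: "partition_on (verts G) P"
    "arcs_ends G = {(u, v). u \<noteq> v \<and> (\<exists>X\<in>P. u \<in> X \<and> v \<in> X)}"
    by (auto simp: cluster_def)
  have unique: "X = Y" if "X \<in> P" "Y \<in> P" "x \<in> X" "x \<in> Y" for X Y x
    using P(1) that by (auto simp: partition_on_def disjoint_def)
  show "adj_trans (arcs_ends G) (verts G)"
    unfolding adj_trans_def P(2) using unique by blast
next
  assume *: "adj_trans (arcs_ends G) (verts G)"
  define R where "R = {(u, v). u \<in> verts G \<and> v \<in> verts G \<and> (u = v \<or> (u, v) \<in> arcs_ends G)}"
  have equiv: "equiv (verts G) R"
  proof (intro equivI refl_onI symI transI)
    fix x y z assume "(x, y) \<in> R" "(y, z) \<in> R"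
    then show "(x, z) \<in> R"
      using * unfolding R_def adj_trans_def by blast
  qed (auto simp: R_def dest: graph_symmetric)
  define P where "P = verts G // R"
  have P: "partition_on (verts G) P"
    unfolding P_def using equiv by (rule partition_on_quotient)
  have same: "X = Y \<longleftrightarrow> (x, y) \<in> R" if "X \<in> P" "Y \<in> P" "x \<in> X" "y \<in> Y" for X Y x y
    using that quotient_eq_iff[OF equiv] unfolding P_def by blast
  have "arcs_ends G = {(u, v). u \<noteq> v \<and> (\<exists>X\<in>P. u \<in> X \<and> v \<in> X)}" (is "_ = ?M")
  proof (intro equalityI subrelI)
    fix u v assume uv: "(u, v) \<in> arcs_ends G"
    then obtain X Y where XY: "X \<in> P" "u \<in> X" "Y \<in> P" "v \<in> Y"
      using P adj_in_verts by (metis partition_on_def UnionE)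
    moreover have "(u, v) \<in> R"
      using uv adj_in_verts by (auto simp: R_def)
    ultimately have "X = Y"
      using same by blast
    then show "(u, v) \<in> ?M"
      using XY uv irrefl_arcs_ends by auto
  next
    fix u v assume "(u, v) \<in> ?M"
    then obtain X where "X \<in> P" "u \<in> X" "v \<in> X" "u \<noteq> v" by auto
    then show "(u, v) \<in> arcs_ends G"
      using same[of X X u v] by (auto simp: R_def)
  qed
  then show "cluster G"
    using P graph_axioms unfolding cluster_def by blast
qed

text \<open>In a cluster, reachability collapses to equality or adjacency, so a set is independent
  iff it has at most one vertex in each component. The bound by independent sets is plainly
  inherited by subsets.\<close>

lemma (in graph) card_components_cluster_le_iff:
  assumes "adj_trans (arcs_ends G) (verts G)"
  shows "card (components G) \<le> k \<longleftrightarrow>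
    (\<forall>J\<subseteq>verts G. independent_set (arcs_ends G) J \<longrightarrow> card J \<le> k)"
proof -
  let ?c = "\<lambda>u. {v. u \<rightarrow>\<^sup>* v}"
  have adj: "u = v \<or> (u, v) \<in> arcs_ends G" if "u \<rightarrow>\<^sup>* v" for u v
    using that
  proof (induct rule: reachable_induct)
    case (step x y)
    then show ?case
      using assms adj_in_verts unfolding adj_trans_def by metis
  qed auto
  have fin: "finite (?c ` verts G)" by simp
  show ?thesis
  proof (intro iffI allI impI)
    fix J assume le: "card (components G) \<le> k" and J: "J \<subseteq> verts G" "independent_set (arcs_ends G) J"
    have "inj_on ?c J"
    proof (rule inj_onI)
      fix x y assume xy: "x \<in> J" "y \<in> J" "?c x = ?c y"
      then have "x \<rightarrow>\<^sup>* y" using J by auto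
      then show "x = y"
        using adj[of x y] xy J by (simp add: independent_set_def)
    qed
    then have "card J \<le> card (?c ` verts G)"
      using J fin by (metis card_image card_mono image_mono)
    then show "card J \<le> k"
      using le by (simp add: card_components)
  next
    assume *: "\<forall>J\<subseteq>verts G. independent_set (arcs_ends G) J \<longrightarrow> card J \<le> k"
    \<comment> \<open>\<open>J\<close> is a system of representatives of the components.\<close>
    obtain J where J: "J \<subseteq> verts G" "inj_on ?c J" "?c ` J = ?c ` verts G"
      by (metis subset_image_inj subset_refl)
    have "independent_set (arcs_ends G) J"
      unfolding independent_set_def
    proof (intro ballI notI)
      fix x y assume xy: "x \<in> J" "y \<in> J" "(x, y) \<in> arcs_ends G"
      then have "x \<rightarrow>\<^sup>* y" "y \<rightarrow>\<^sup>* x"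
        using symmetric_reachable' by auto
      then have "?c x = ?c y"
        using reachable_trans by blast
      then have "x = y"
        using J xy by (auto dest: inj_onD)
      then show False
        using xy irrefl_arcs_ends by auto
    qed
    then have "card J \<le> k"
      using * J by blast
    then show "card (components G) \<le> k"
      using J by (metis card_components card_image)
  qed
qed

text \<open>With \<open>\<infinity>\<close> as the bound on parts, only their existence is asked of
  \<open>A\<close>. Inducing on \<open>A\<close> or \<open>B\<close> inside \<open>X\<close> is the
  same as inducing in \<open>G\<close>, so every condition can refer to the one relation
  \<open>arcs_ends G\<close>.\<close>

lemma (in graph) polar_iff_polar_set:
  assumes X: "X \<subseteq> verts G"
  shows "polar \<infinity> (enat k) (G \<restriction> X) \<longleftrightarrow> polar_set k (arcs_ends G) X"
proof -
  have *: "polar_partition \<infinity> (enat k) (G \<restriction> X) A B \<longleftrightarrow>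
      A \<union> B = X \<and> A \<inter> B = {} \<and> nonadj_trans (arcs_ends G) A \<and> adj_trans (arcs_ends G) B \<and>
        (\<forall>J\<subseteq>B. independent_set (arcs_ends G) J \<longrightarrow> card J \<le> k)" for A B
  proof (cases "A \<union> B = X")
    case True
    then have AB: "A \<subseteq> X" "B \<subseteq> X" by auto
    then have gr: "graph (G \<restriction> A)" "graph (G \<restriction> B)"
      using X graph_induce_subgraph by blast+
    have A: "(\<exists>P. complete_multipartite_with_parts (G \<restriction> A) P) \<longleftrightarrow> nonadj_trans (arcs_ends G) A"
      using graph.complete_multipartite_iff[OF gr(1)]
      by (simp add: nonadj_trans_Restr arcs_ends_induce_subgraph)
    have B: "cluster (G \<restriction> B) \<longleftrightarrow> adj_trans (arcs_ends G) B"
      using graph.cluster_iff[OF gr(2)]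
      by (simp add: adj_trans_Restr arcs_ends_induce_subgraph)
    have C: "card (components (G \<restriction> B)) \<le> k \<longleftrightarrow>
        (\<forall>J\<subseteq>B. independent_set (arcs_ends G) J \<longrightarrow> card J \<le> k)" if "adj_trans (arcs_ends G) B"
      using graph.card_components_cluster_le_iff[OF gr(2), of k] that
      by (simp add: arcs_ends_induce_subgraph adj_trans_Restr independent_set_Restr)
    show ?thesis
      using A B C True AB
      by (simp add: polar_partition_def induce_subgraph_induce_subgraph) blast
  qed (auto simp: polar_partition_def)
  show ?thesis
    unfolding polar_def polar_set_def * by simp
qed

text \<open>An induced subgraph is determined by its vertex set, so minimality becomes a condition
  on proper subsets of \<open>verts G\<close>.\<close>

lemma (in graph) minimal_obstruction_iff:
  "cograph_minimal_polar_obstruction \<infinity> (enat k) G \<longleftrightarrow>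
     cograph G \<and> \<not> polar_set k (arcs_ends G) (verts G) \<and>
     (\<forall>X\<subset>verts G. polar_set k (arcs_ends G) X)"
proof -
  have ind: "induced_subgraph H G \<and> H \<noteq> G \<longleftrightarrow> (\<exists>X\<subset>verts G. H = G \<restriction> X)" for H
  proof
    assume H: "induced_subgraph H G \<and> H \<noteq> G"
    then have "G \<restriction> verts H = H" "verts H \<subseteq> verts G"
      using induce_eq_iff_induced by auto
    moreover from this have "verts H \<noteq> verts G"
      using H induce_subgraph_verts_eq by auto
    ultimately show "\<exists>X\<subset>verts G. H = G \<restriction> X"
      by (intro exI[of _ "verts H"]) auto
  next
    assume "\<exists>X\<subset>verts G. H = G \<restriction> X"
    then obtain X where X: "X \<subset> verts G" "H = G \<restriction> X" by auto
    then have "verts H \<noteq> verts G" by simp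
    then have "H \<noteq> G" by blast
    then show "induced_subgraph H G \<and> H \<noteq> G"
      using X by blast
  qed
  have "polar \<infinity> (enat k) G \<longleftrightarrow> polar_set k (arcs_ends G) (verts G)"
    using polar_iff_polar_set[of "verts G" k] by (simp add: induce_subgraph_verts_eq)
  moreover have "(\<forall>X\<subset>verts G. polar \<infinity> (enat k) (G \<restriction> X)) \<longleftrightarrow>
      (\<forall>X\<subset>verts G. polar_set k (arcs_ends G) X)"
    using polar_iff_polar_set[OF psubset_imp_subset] by simp
  ultimately show ?thesis
    unfolding cograph_minimal_polar_obstruction_def ind by auto
qed

subsection \<open>Complete tripartite graphs with isolated vertices\<close>

definition tripartite_arcs :: "'a set \<Rightarrow> 'a set \<Rightarrow> 'a set \<Rightarrow> 'a rel" where
  "tripartite_arcs X Y Z =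
     X \<times> Y \<union> Y \<times> X \<union> X \<times> Z \<union> Z \<times> X \<union> Y \<times> Z \<union> Z \<times> Y"

definition disjoint4 :: "'a set \<Rightarrow> 'a set \<Rightarrow> 'a set \<Rightarrow> 'a set \<Rightarrow> bool" where
  "disjoint4 I X Y Z \<longleftrightarrow>
     I \<inter> X = {} \<and> I \<inter> Y = {} \<and> I \<inter> Z = {} \<and> X \<inter> Y = {} \<and> X \<inter> Z = {} \<and> Y \<inter> Z = {}"

text \<open>\<open>Z\<close> may be empty, which gives the complete bipartite graphs.\<close>

definition isolated_plus_tripartite ::
    "('a, 'b) pre_digraph \<Rightarrow> 'a set \<Rightarrow> 'a set \<Rightarrow> 'a set \<Rightarrow> 'a set \<Rightarrow> bool" where
  "isolated_plus_tripartite G I X Y Z \<longleftrightarrow>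
     disjoint4 I X Y Z \<and> finite (I \<union> X \<union> Y \<union> Z) \<and> verts G = I \<union> X \<union> Y \<union> Z \<and>
     arcs_ends G = tripartite_arcs X Y Z"

text \<open>The part sizes of \<open>K\<^bsub>k+1,k+1\<^esub>\<close> and of \<open>K\<^sub>1 \<oplus> C\<^sub>4 = K\<^bsub>1,2,2\<^esub>\<close>.\<close>

definition critical_sizes :: "nat \<Rightarrow> 'a set \<Rightarrow> 'a set \<Rightarrow> 'a set \<Rightarrow> bool" where
  "critical_sizes k X Y Z \<longleftrightarrow>
     card X = k + 1 \<and> card Y = k + 1 \<and> Z = {} \<or> card X = 2 \<and> card Y = 2 \<and> card Z = 1"

section \<open>Building and restricting polar partitions\<close>

lemma nonadj_trans_if_independent: "independent_set E A \<Longrightarrow> nonadj_trans E A"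
  by (auto simp: independent_set_def nonadj_trans_def)

lemma adj_trans_if_independent: "independent_set E B \<Longrightarrow> adj_trans E B"
  by (auto simp: independent_set_def adj_trans_def)

text \<open>An edgeless \<open>B\<close> is a cluster with one component per vertex.\<close>

lemma polar_setI_edgeless:
  assumes "nonadj_trans E A" "independent_set E B" "finite B" "card B \<le> k" "A \<inter> B = {}"
  shows "polar_set k E (A \<union> B)"
proof -
  have "card J \<le> k" if "J \<subseteq> B" for J
    using card_mono[OF \<open>finite B\<close> that] \<open>card B \<le> k\<close> by simp
  then show ?thesis
    unfolding polar_set_def using assms adj_trans_if_independent
    by (intro exI[of _ A] exI[of _ B]) simp
qed

text \<open>A clique is a cluster with at most one component; \<open>1 \<le> k\<close> leaves room
  for it.\<close>

lemma polar_setI_clique: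
  assumes "nonadj_trans E A" "\<And>x y. x \<in> B \<Longrightarrow> y \<in> B \<Longrightarrow> x \<noteq> y \<Longrightarrow> (x, y) \<in> E" "A \<inter> B = {}" "1 \<le> k"
  shows "polar_set k E (A \<union> B)"
proof -
  have "adj_trans E B"
    using assms(2) by (auto simp: adj_trans_def)
  moreover have "card J \<le> k" if "J \<subseteq> B" "independent_set E J" for J
  proof (cases "J = {}")
    case False
    then obtain x where "x \<in> J" by blast
    then have "J = {x}"
      using assms(2) that unfolding independent_set_def by blast
    then show ?thesis using assms(4) by simp
  qed simp
  ultimately show ?thesis
    unfolding polar_set_def using assms by blast
qed

text \<open>All conditions on the two sides pass to subsets. Minimality therefore has to be checked
  only for deletions of single vertices.\<close>

lemma polar_set_mono:
  assumes "polar_set k E X" "Y \<subseteq> X"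
  shows "polar_set k E Y"
proof -
  from assms(1) obtain A B where AB: "A \<union> B = X" "A \<inter> B = {}" "nonadj_trans E A" "adj_trans E B"
    "\<forall>J\<subseteq>B. independent_set E J \<longrightarrow> card J \<le> k"
    unfolding polar_set_def by auto
  have "nonadj_trans E (A \<inter> Y)" "adj_trans E (B \<inter> Y)"
    using AB unfolding nonadj_trans_def adj_trans_def by blast+
  moreover have "(A \<inter> Y) \<union> (B \<inter> Y) = Y" "(A \<inter> Y) \<inter> (B \<inter> Y) = {}"
    using AB assms(2) by blast+
  ultimately show ?thesis
    unfolding polar_set_def using AB(5) by (metis le_infE)
qed

section \<open>The two candidate graphs: not polar, but polar after any deletion\<close>

text \<open>An isolated vertex in \<open>A\<close> makes \<open>A\<close> independent, so
  \<open>A\<close> meets at most one of \<open>X\<close>, \<open>Y\<close>, \<open>Z\<close>. Then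
  \<open>B\<close> contains either a side with \<open>k + 1\<close> independent vertices or an
  induced path on three vertices. Only the trace of \<open>E\<close> on the four sets is prescribed,
  so the lemma also applies inside a larger graph.\<close>

lemma not_polar_set_critical:
  assumes V: "disjoint4 I X Y Z" "X \<union> Y \<union> Z \<union> I \<subseteq> V" "card I = k + 1" "critical_sizes k X Y Z"
    and E: "E \<inter> (I \<union> X \<union> Y \<union> Z) \<times> (I \<union> X \<union> Y \<union> Z) = tripartite_arcs X Y Z"
  shows "\<not> polar_set k E V"
proof
  assume "polar_set k E V"
  then obtain A B where AB: "A \<union> B = V" "A \<inter> B = {}" "nonadj_trans E A" "adj_trans E B"
    and J: "\<And>J. J \<subseteq> B \<Longrightarrow> independent_set E J \<Longrightarrow> card J \<le> k"
    unfolding polar_set_def by auto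
  have dis: "I \<inter> X = {}" "I \<inter> Y = {}" "I \<inter> Z = {}" "X \<inter> Y = {}" "X \<inter> Z = {}" "Y \<inter> Z = {}"
    using V(1) by (auto simp: disjoint4_def)
  have adj: "(u, v) \<in> E \<longleftrightarrow> (u, v) \<in> tripartite_arcs X Y Z"
    if "u \<in> I \<union> X \<union> Y \<union> Z" "v \<in> I \<union> X \<union> Y \<union> Z" for u v
    using E that by blast
  have indep: "independent_set E I" "independent_set E X" "independent_set E Y"
    using dis by (auto simp: independent_set_def adj tripartite_arcs_def)
  have "\<not> I \<subseteq> B"
    using J[OF _ indep(1)] V(3) by auto
  then obtain i where i: "i \<in> I" "i \<in> A"
    using AB V(2) by blast
  \<comment> \<open>Non-adjacency is passed on through the isolated vertex \<open>i\<close>.\<close>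
  have A: "(x, y) \<notin> E" if "x \<in> A" "y \<in> A" "x \<in> X \<union> Y \<union> Z" "y \<in> X \<union> Y \<union> Z" for x y
  proof -
    have "(x, i) \<notin> E" "(i, y) \<notin> E"
      using that i dis by (auto simp: adj tripartite_arcs_def)
    then show ?thesis
      using AB(3) that i unfolding nonadj_trans_def by blast
  qed
  \<comment> \<open>The vertices \<open>x1\<close>, \<open>z\<close>, \<open>x2\<close> would form
    an induced path in the cluster \<open>B\<close>.\<close>
  have P3: False if "x1 \<in> P" "x2 \<in> P" "x1 \<noteq> x2" "z \<in> Q" "P \<subseteq> B" "Q \<subseteq> B" "P \<in> {X, Y}" "Q \<in> {X, Y, Z}" "P \<noteq> Q" for x1 x2 z P Q
  proof -
    have "(x1, z) \<in> E" "(z, x2) \<in> E" "(x1, x2) \<notin> E"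
      using that dis by (auto simp: adj tripartite_arcs_def)
    then show False
      using AB(4) that unfolding adj_trans_def by blast
  qed
  have side: "Q \<subseteq> B" if "P \<inter> A \<noteq> {}" "P \<in> {X, Y, Z}" "Q \<in> {X, Y, Z}" "P \<noteq> Q" for P Q
  proof
    fix q assume q: "q \<in> Q"
    from that obtain p where p: "p \<in> P" "p \<in> A" by blast
    have "(p, q) \<in> E"
      using p q that by (auto simp: adj tripartite_arcs_def)
    then have "q \<notin> A"
      using A p q that by blast
    then show "q \<in> B"
      using q that AB(1) V(2) by blast
  qed
  have notin: "P \<subseteq> B" if "P \<inter> A = {}" "P \<in> {X, Y, Z}" for P
    using that AB V(2) by blast
  from V(4) show False
    unfolding critical_sizes_def
  proof (elim disjE conjE)
    assume c: "card X = k + 1" "card Y = k + 1" "Z = {}"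
    then have "X \<noteq> Y"
      using dis by force
    then have "X \<subseteq> B \<or> Y \<subseteq> B"
      using side[of X Y] notin[of X] by blast
    then show False
      using J[of X] J[of Y] indep c by auto
  next
    assume c: "card X = 2" "card Y = 2" "card Z = 1"
    then obtain x1 x2 y1 y2 z where xyz: "x1 \<in> X" "x2 \<in> X" "x1 \<noteq> x2" "y1 \<in> Y" "y2 \<in> Y" "y1 \<noteq> y2" "z \<in> Z"
      by (metis card_1_singletonE card_2_iff insertI1 insertI2)
    then have ne: "X \<noteq> Y" "X \<noteq> Z" "Y \<noteq> Z"
      using dis by blast+
    show False
    \<comment> \<open>Since \<open>A\<close> meets at most one part, in every case \<open>B\<close>
      contains a two-element part together with another whole part, contrary to
      \<open>P3\<close>.\<close>
    proof (cases "X \<inter> A = {}")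
      case True
      then have X: "X \<subseteq> B" using notin by blast
      show False
      proof (cases "Y \<inter> A = {}")
        case True
        then show False
          using P3[of x1 X x2 y1 Y] X notin[of Y] xyz ne by blast
      next
        case False
        then have "Z \<subseteq> B" using side[of Y Z] ne by blast
        then show False
          using P3[of x1 X x2 z Z] X xyz ne by blast
      qed
    next
      case False
      then have "Z \<subseteq> B" "Y \<subseteq> B" using side[of X Z] side[of X Y] ne by blast+
      then show False
        using P3[of y1 Y y2 z Z] xyz ne by blast
    qed
  qed
qed

lemma nonadj_trans_tripartite:
  assumes "disjoint4 I X Y Z"
  shows "nonadj_trans (tripartite_arcs X Y Z) (X \<union> Y \<union> Z)"
  unfolding nonadj_trans_def
proof (intro ballI impI)
  fix x y z assume "x \<in> X \<union> Y \<union> Z" "y \<in> X \<union> Y \<union> Z" "z \<in> X \<union> Y \<union> Z"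
    "(x, y) \<notin> tripartite_arcs X Y Z" "(y, z) \<notin> tripartite_arcs X Y Z"
  then show "(x, z) \<notin> tripartite_arcs X Y Z"
    using assms by (auto simp: tripartite_arcs_def disjoint4_def)
qed

text \<open>If \<open>v\<close> is isolated, the other \<open>k\<close> isolated vertices form the
  cluster and the tripartite graph is the multipartite side. Otherwise \<open>I\<close> joins
  \<open>X\<close> or \<open>Y\<close> to form an independent side, and what remains is an edge or
  at most \<open>k\<close> independent vertices.\<close>

lemma polar_set_delete_vertex:
  assumes V: "disjoint4 I X Y Z" "finite (I \<union> X \<union> Y \<union> Z)" "card I = k + 1" "critical_sizes k X Y Z"
    and "k \<ge> 2" "v \<in> I \<union> X \<union> Y \<union> Z"
  shows "polar_set k (tripartite_arcs X Y Z) (I \<union> X \<union> Y \<union> Z - {v})" (is "polar_set k ?E _")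
proof -
  have dis: "I \<inter> X = {}" "I \<inter> Y = {}" "I \<inter> Z = {}" "X \<inter> Y = {}" "X \<inter> Z = {}" "Y \<inter> Z = {}"
    using V(1) by (auto simp: disjoint4_def)
  have indep: "independent_set ?E I" "independent_set ?E (I \<union> X)" "independent_set ?E (I \<union> Y)"
    using dis unfolding independent_set_def tripartite_arcs_def by blast+
  have fin: "finite I" "finite X" "finite Y" "finite Z"
    using V(2) by auto
  note nonadj = nonadj_trans_if_independent[OF indep(2)] nonadj_trans_if_independent[OF indep(3)]
  consider (I) "v \<in> I" | (X) "v \<in> X" | (Y) "v \<in> Y" | (Z) "v \<in> Z"
    using assms(6) by blast
  then show ?thesis
  proof cases
    case I
    have "independent_set ?E (I - {v})"
      using indep(1) by (auto simp: independent_set_def)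
    moreover have "card (I - {v}) \<le> k"
      using I V(3) fin by simp
    ultimately have "polar_set k ?E ((X \<union> Y \<union> Z) \<union> (I - {v}))"
      using nonadj_trans_tripartite[OF V(1)] dis fin by (intro polar_setI_edgeless) auto
    moreover have "(X \<union> Y \<union> Z) \<union> (I - {v}) = I \<union> X \<union> Y \<union> Z - {v}"
      using I dis by blast
    ultimately show ?thesis by simp
  next
    case X
    have "polar_set k ?E ((I \<union> Y) \<union> (X - {v} \<union> Z))"
      using V(4) unfolding critical_sizes_def
    proof (elim disjE conjE)
      assume c: "card X = k + 1" "Z = {}"
      have "independent_set ?E (X - {v} \<union> Z)"
        using indep(2) c by (auto simp: independent_set_def)
      then show ?thesis
        using nonadj(2) c dis fin X by (intro polar_setI_edgeless) auto
    next
      assume c: "card X = 2" "card Z = 1"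
      then obtain x z where x: "X - {v} = {x}" "Z = {z}"
        by (metis X card_1_singletonE card_Diff_singleton diff_add_inverse2 one_add_one)
      then show ?thesis
        using nonadj(2) dis \<open>k \<ge> 2\<close> by (intro polar_setI_clique) (auto simp: tripartite_arcs_def)
    qed
    moreover have "(I \<union> Y) \<union> (X - {v} \<union> Z) = I \<union> X \<union> Y \<union> Z - {v}"
      using X dis by blast
    ultimately show ?thesis by simp
  next
    case Y
    have "polar_set k ?E ((I \<union> X) \<union> (Y - {v} \<union> Z))"
      using V(4) unfolding critical_sizes_def
    proof (elim disjE conjE)
      assume c: "card Y = k + 1" "Z = {}"
      have "independent_set ?E (Y - {v} \<union> Z)"
        using indep(3) c by (auto simp: independent_set_def)
      then show ?thesis
        using nonadj(1) c dis fin Y by (intro polar_setI_edgeless) auto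
    next
      assume c: "card Y = 2" "card Z = 1"
      then obtain y z where y: "Y - {v} = {y}" "Z = {z}"
        by (metis Y card_1_singletonE card_Diff_singleton diff_add_inverse2 one_add_one)
      then show ?thesis
        using nonadj(1) dis \<open>k \<ge> 2\<close> by (intro polar_setI_clique) (auto simp: tripartite_arcs_def)
    qed
    moreover have "(I \<union> X) \<union> (Y - {v} \<union> Z) = I \<union> X \<union> Y \<union> Z - {v}"
      using Y dis by blast
    ultimately show ?thesis by simp
  next
    case Z
    then have c: "card Y = 2" "Z = {v}"
      using V(4) by (auto simp: critical_sizes_def card_1_singleton_iff)
    have "independent_set ?E Y"
      using indep(3) by (auto simp: independent_set_def)
    \<comment> \<open>The cluster \<open>Y\<close> consists of two isolated vertices; this case
      needs the full strength of \<open>k \<ge> 2\<close>.\<close>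
    then have "polar_set k ?E ((I \<union> X) \<union> Y)"
      using nonadj(1) c dis fin \<open>k \<ge> 2\<close> by (intro polar_setI_edgeless) auto
    moreover have "(I \<union> X) \<union> Y = I \<union> X \<union> Y \<union> Z - {v}"
      using Z c dis by blast
    ultimately show ?thesis by simp
  qed
qed

section \<open>Structure of a minimal obstruction\<close>

text \<open>A critical configuration is only located inside \<open>V\<close>. As it is already not
  polar, \<open>min\<close> turns the inclusion into an equality, which also determines
  \<open>E\<close>.\<close>

lemma critical_structure:
  assumes fin: "finite V" and sym: "sym E" and irr: "irrefl E" and EV: "E \<subseteq> V \<times> V"
    and I: "I \<subseteq> V" "card I = k + 1" "\<And>i v. i \<in> I \<Longrightarrow> (i, v) \<notin> E"
    and non: "\<not> polar_set k E V" and min: "\<And>X. X \<subset> V \<Longrightarrow> polar_set k E X"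
    and k: "k \<ge> 2"
  shows "\<exists>X Y Z. disjoint4 I X Y Z \<and> V = I \<union> X \<union> Y \<union> Z \<and> E = tripartite_arcs X Y Z \<and>
    critical_sizes k X Y Z"
proof -
  define W where "W = V - I"
  have V: "V = I \<union> W" and IW: "I \<inter> W = {}"
    using I by (auto simp: W_def)
  have finI: "finite I" and finW: "finite W"
    using fin V by auto
  have symE: "(x, y) \<in> E \<longleftrightarrow> (y, x) \<in> E" for x y
    using sym by (auto dest: symD)
  have irrE: "(x, x) \<notin> E" for x
    using irr by (auto simp: irrefl_def)
  have I2: "(v, i) \<notin> E" if "i \<in> I" for i v
    using I(3) symE that by blast
  have indepI: "independent_set E (I \<union> A)" if "independent_set E A" for A
    using that I(3) I2 by (auto simp: independent_set_def)
  have W: "nonadj_trans E W"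
  proof -
    have "I \<noteq> {}" using I(2) by auto
    then obtain i where i: "i \<in> I" by blast
    then have "V - {i} \<subset> V" using I(1) by blast
    from min[OF this] obtain A B where AB: "A \<union> B = V - {i}" "A \<inter> B = {}" "nonadj_trans E A" "adj_trans E B"
      and J: "\<And>J. J \<subseteq> B \<Longrightarrow> independent_set E J \<Longrightarrow> card J \<le> k"
      unfolding polar_set_def by auto
    \<comment> \<open>If \<open>A\<close> kept an isolated vertex, it would be independent; moving
      all of \<open>I\<close> into it would then give a polar partition of \<open>V\<close>.\<close>
    have "A \<inter> I = {}"
    proof (rule ccontr)
      assume "A \<inter> I \<noteq> {}"
      then obtain j where j: "j \<in> A" "j \<in> I" by blast
      have "independent_set E A"
        unfolding independent_set_def
      proof (intro ballI)
        fix x y assume "x \<in> A" "y \<in> A"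
        moreover have "(x, j) \<notin> E" "(j, y) \<notin> E"
          using j I(3) I2 by auto
        ultimately show "(x, y) \<notin> E"
          using AB(3) j unfolding nonadj_trans_def by blast
      qed
      then have "nonadj_trans E (I \<union> A)"
        by (intro nonadj_trans_if_independent indepI)
      moreover have "adj_trans E (B - I)"
        using AB(4) unfolding adj_trans_def by blast
      moreover have "(I \<union> A) \<union> (B - I) = V" "(I \<union> A) \<inter> (B - I) = {}"
        using AB(1,2) V i by blast+
      moreover have "\<forall>J\<subseteq>B - I. independent_set E J \<longrightarrow> card J \<le> k"
        using J by blast
      ultimately have "polar_set k E V"
        unfolding polar_set_def by blast
      then show False using non by blast
    qed
    then have IB: "I - {i} \<subseteq> B"
      using AB(1) V by blast
    \<comment> \<open>\<open>B\<close> already contains the \<open>k\<close> remaining isolated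
      vertices, and any further vertex would complete an independent set of size
      \<open>k + 1\<close>.\<close>
    have "B \<inter> W = {}"
    proof (rule ccontr)
      assume "B \<inter> W \<noteq> {}"
      then obtain w where w: "w \<in> B" "w \<in> W" by blast
      have "independent_set E (insert w (I - {i}))"
        using I(3) I2 irrE by (auto simp: independent_set_def)
      moreover have "insert w (I - {i}) \<subseteq> B"
        using IB w by blast
      moreover have "card (insert w (I - {i})) = k + 1"
        using w IW finI I(2) i by (subst card_insert_disjoint) auto
      ultimately show False
        using J[of "insert w (I - {i})"] by simp
    qed
    then have "W \<subseteq> A"
      using AB(1) V i IW by blast
    then show ?thesis
      using AB(3) unfolding nonadj_trans_def by blast
  qed
  have Wt: "(x, z) \<notin> E" if "x \<in> W" "y \<in> W" "z \<in> W" "(x, y) \<notin> E" "(y, z) \<notin> E" for x y z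
    using W that unfolding nonadj_trans_def by blast
  \<comment> \<open>Otherwise \<open>I \<union> A\<close> and the clique \<open>W - A\<close> would
    be a polar partition of \<open>V\<close>.\<close>
  have notclique: "\<exists>x\<in>W - A. \<exists>y\<in>W - A. x \<noteq> y \<and> (x, y) \<notin> E" if A: "A \<subseteq> W" "independent_set E A" for A
  proof (rule ccontr)
    assume "\<not> ?thesis"
    then have "polar_set k E ((I \<union> A) \<union> (W - A))"
      using k IW indepI[OF A(2)] nonadj_trans_if_independent by (intro polar_setI_clique) auto
    moreover have "(I \<union> A) \<union> (W - A) = V"
      using A V by blast
    ultimately show False using non by simp
  qed
  \<comment> \<open>\<open>N x\<close> is the part containing \<open>x\<close> in the complete
    multipartite graph on \<open>W\<close>.\<close>
  define N where "N x = {y \<in> W. (x, y) \<notin> E}" for x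
  have N: "independent_set E (N x)" if "x \<in> W" for x
    using Wt that symE unfolding independent_set_def N_def by blast
  have NW: "N x \<subseteq> W" "x \<in> W \<Longrightarrow> x \<in> N x" for x
    using irrE by (auto simp: N_def)
  \<comment> \<open>Choosing \<open>A\<close> empty gives two vertices in a common part; choosing
    \<open>A\<close> as that part then gives two vertices in a second one.\<close>
  obtain x1 x2 where x: "x1 \<in> W" "x2 \<in> W" "x1 \<noteq> x2" "(x1, x2) \<notin> E"
    using notclique[of "{}"] by (auto simp: independent_set_def)
  obtain y1 y2 where y: "y1 \<in> W - N x1" "y2 \<in> W - N x1" "y1 \<noteq> y2" "(y1, y2) \<notin> E"
    using notclique[OF NW(1) N[OF x(1)]] by blast
  have NN: "(a, b) \<in> E" if "a \<in> N x" "b \<in> W" "b \<notin> N x" "x \<in> W" for a b x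
    using that Wt symE unfolding N_def by blast
  have xW: "x1 \<in> W" "y1 \<in> W" "N x1 \<subseteq> W" "N y1 \<subseteq> W"
    using x y NW by auto
  have disN: "N x1 \<inter> N y1 = {}"
    using y xW Wt symE unfolding N_def by blast
  have whole: "V = T" if "T \<subseteq> V" "\<not> polar_set k E T" for T
    using that min by blast
  \<comment> \<open>Sets of critical sizes, taken from the two parts and from the rest of
    \<open>W\<close>, already induce a non-polar graph together with \<open>I\<close>; by
    \<open>whole\<close> they exhaust \<open>V\<close>.\<close>
  have crit: "disjoint4 I X Y Z \<and> V = I \<union> X \<union> Y \<union> Z \<and> E = tripartite_arcs X Y Z \<and>
      critical_sizes k X Y Z"
    if XYZ: "X \<subseteq> N x1" "Y \<subseteq> N y1" "Z \<subseteq> W - N x1 - N y1" "independent_set E Z" "critical_sizes k X Y Z" for X Y Z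
  proof -
    have dis: "disjoint4 I X Y Z"
      using XYZ disN IW xW unfolding disjoint4_def by blast
    let ?T = "I \<union> X \<union> Y \<union> Z"
    have adj: "(a, b) \<in> E" if "(a, b) \<in> tripartite_arcs X Y Z" for a b
      using that XYZ NN[of _ x1] NN[of _ y1] symE xW disN unfolding tripartite_arcs_def by blast
    have nonadj: "(a, b) \<in> tripartite_arcs X Y Z" if "(a, b) \<in> E" "a \<in> ?T" "b \<in> ?T" for a b
      using that XYZ N[OF xW(1)] N[OF xW(2)] I(3) I2 unfolding tripartite_arcs_def independent_set_def
      by blast
    have T: "E \<inter> ?T \<times> ?T = tripartite_arcs X Y Z"
    proof (intro equalityI subrelI)
      fix a b assume "(a, b) \<in> tripartite_arcs X Y Z"
      then show "(a, b) \<in> E \<inter> ?T \<times> ?T"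
        using adj by (auto simp: tripartite_arcs_def)
    next
      fix a b assume "(a, b) \<in> E \<inter> ?T \<times> ?T"
      then show "(a, b) \<in> tripartite_arcs X Y Z"
        using nonadj by (meson IntE mem_Sigma_iff)
    qed
    have "\<not> polar_set k E ?T"
      by (rule not_polar_set_critical[OF dis _ I(2) XYZ(5) T]) auto
    then have "V = ?T"
      using whole[of ?T] XYZ xW V by blast
    then show ?thesis
      using dis XYZ(5) T EV by (simp add: Int_absorb2)
  qed
  show ?thesis
  proof (cases "N x1 \<union> N y1 = W")
    case False
    then obtain z where z: "z \<in> W - N x1 - N y1"
      using xW by blast
    have "y2 \<in> N y1"
      using y by (auto simp: N_def)
    moreover have "critical_sizes k {x1, x2} {y1, y2} {z}"
      using x y by (simp add: critical_sizes_def)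
    ultimately show ?thesis
      using crit[of "{x1, x2}" "{y1, y2}" "{z}"] x y z NW(2) irrE by (auto simp: N_def independent_set_def)
  next
    case True
    \<comment> \<open>Here \<open>W\<close> is bipartite; a side \<open>P\<close> with at most
      \<open>k\<close> vertices could serve as the cluster, with \<open>I \<union> Q\<close> as the
      independent side.\<close>
    have large: "k + 1 \<le> card P" if "P \<union> Q = W" "P \<inter> Q = {}" "independent_set E P" "independent_set E Q" for P Q
    proof (rule ccontr)
      assume "\<not> ?thesis"
      then have "polar_set k E ((I \<union> Q) \<union> P)"
        using that finW IW nonadj_trans_if_independent[OF indepI]
        by (intro polar_setI_edgeless) (auto intro: finite_subset)
      moreover have "(I \<union> Q) \<union> P = V"
        using that V by blast
      ultimately show False using non by simp
    qed
    have "k + 1 \<le> card (N x1)" "k + 1 \<le> card (N y1)"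
      using large[of "N x1" "N y1"] large[of "N y1" "N x1"] True disN N xW by blast+
    \<comment> \<open>The sides may a priori be larger than \<open>k + 1\<close>;
      \<open>crit\<close> shows afterwards that nothing was left out.\<close>
    then obtain X Y where "X \<subseteq> N x1" "card X = k + 1" "Y \<subseteq> N y1" "card Y = k + 1"
      by (metis obtain_subset_with_card_n)
    then show ?thesis
      using crit[of X Y "{}"] by (auto simp: critical_sizes_def independent_set_def)
  qed
qed

section \<open>Isomorphism types and the concrete graphs\<close>

lemma isolated_plus_tripartite_iso:
  assumes G: "isolated_plus_tripartite G I X Y Z" and "digraph_iso G H" "wf_digraph H"
  obtains I' X' Y' Z' where "isolated_plus_tripartite H I' X' Y' Z'"
    "card I' = card I" "card X' = card X" "card Y' = card Y" "card Z' = card Z"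
proof -
  interpret H: wf_digraph H by fact
  obtain f where f: "bij_betw f (verts G) (verts H)"
    and adj: "\<And>u v. u \<in> verts G \<Longrightarrow> v \<in> verts G \<Longrightarrow>
      (u, v) \<in> arcs_ends G \<longleftrightarrow> (f u, f v) \<in> arcs_ends H"
    using digraph_isoE[OF assms(2)] by metis
  have inj: "inj_on f (verts G)" and im: "f ` verts G = verts H"
    using f by (auto simp: bij_betw_def)
  have V: "verts G = I \<union> X \<union> Y \<union> Z" and E: "arcs_ends G = tripartite_arcs X Y Z"
    and dis: "disjoint4 I X Y Z" and fin: "finite (verts G)"
    using G by (auto simp: isolated_plus_tripartite_def)
  have sub: "I \<subseteq> verts G" "X \<subseteq> verts G" "Y \<subseteq> verts G" "Z \<subseteq> verts G"
    using V by auto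
  have "disjoint4 (f ` I) (f ` X) (f ` Y) (f ` Z)"
    using dis sub inj by (simp add: disjoint4_def inj_on_image_Int[OF inj, symmetric])
  moreover have "verts H = f ` I \<union> f ` X \<union> f ` Y \<union> f ` Z"
    using im V by auto
  moreover have "arcs_ends H = tripartite_arcs (f ` X) (f ` Y) (f ` Z)"
  proof -
    have "arcs_ends H = map_prod f f ` arcs_ends G"
    proof (intro equalityI subrelI)
      fix a b assume ab: "(a, b) \<in> arcs_ends H"
      then obtain u v where "a = f u" "b = f v" "u \<in> verts G" "v \<in> verts G"
        using H.adj_in_verts im by blast
      then show "(a, b) \<in> map_prod f f ` arcs_ends G"
        using adj ab by (auto intro!: image_eqI[of _ _ "(u, v)"])
    next
      fix a b assume "(a, b) \<in> map_prod f f ` arcs_ends G"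
      then obtain u v where uv: "a = f u" "b = f v" "(u, v) \<in> arcs_ends G" by auto
      then have "u \<in> verts G" "v \<in> verts G"
        using E sub by (auto simp: tripartite_arcs_def)
      then show "(a, b) \<in> arcs_ends H"
        using adj uv by blast
    qed
    then show ?thesis
      by (simp add: E tripartite_arcs_def image_Un map_prod_surj_on)
  qed
  ultimately have "isolated_plus_tripartite H (f ` I) (f ` X) (f ` Y) (f ` Z)"
    using fin V by (auto simp: isolated_plus_tripartite_def)
  moreover have "card (f ` S) = card S" if "S \<subseteq> verts G" for S
    using that inj card_image inj_on_subset by blast
  ultimately show thesis
    using that[of "f ` I" "f ` X" "f ` Y" "f ` Z"] sub by simp
qed

text \<open>Bijections between corresponding sets glue together by disjointness, and adjacency
  depends only on which set each vertex belongs to.\<close>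

lemma isolated_plus_tripartite_iso_if_card_eq:
  assumes G: "isolated_plus_tripartite G I X Y Z" and H: "isolated_plus_tripartite H I' X' Y' Z'"
    and card: "card I = card I'" "card X = card X'" "card Y = card Y'" "card Z = card Z'"
    and "nomulti_digraph G" "nomulti_digraph H"
  shows "digraph_iso G H"
proof -
  have V: "verts G = I \<union> X \<union> Y \<union> Z" "verts H = I' \<union> X' \<union> Y' \<union> Z'"
    and E: "arcs_ends G = tripartite_arcs X Y Z" "arcs_ends H = tripartite_arcs X' Y' Z'"
    and dis: "disjoint4 I X Y Z" "disjoint4 I' X' Y' Z'"
    and fin: "finite (verts G)" "finite (verts H)"
    using G H by (auto simp: isolated_plus_tripartite_def)
  have fins: "finite I" "finite X" "finite Y" "finite Z" "finite I'" "finite X'" "finite Y'" "finite Z'"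
    using V fin by auto
  obtain fI fX fY fZ where bij: "bij_betw fI I I'" "bij_betw fX X X'" "bij_betw fY Y Y'" "bij_betw fZ Z Z'"
    using card fins by (metis finite_same_card_bij)
  define f where "f v = (if v \<in> I then fI v else if v \<in> X then fX v else if v \<in> Y then fY v else fZ v)" for v
  have "f v = fI v" if "v \<in> I" for v
    using that by (simp add: f_def)
  moreover have "f v = fX v" if "v \<in> X" for v
    using that dis(1) by (auto simp: f_def disjoint4_def)
  moreover have "f v = fY v" if "v \<in> Y" for v
    using that dis(1) by (auto simp: f_def disjoint4_def)
  moreover have "f v = fZ v" if "v \<in> Z" for v
    using that dis(1) by (auto simp: f_def disjoint4_def)
  ultimately have fb: "bij_betw f I I'" "bij_betw f X X'" "bij_betw f Y Y'" "bij_betw f Z Z'"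
    using bij by (simp_all cong: bij_betw_cong)
  have "bij_betw f (((I \<union> X) \<union> Y) \<union> Z) (((I' \<union> X') \<union> Y') \<union> Z')"
    using dis(2) by (intro bij_betw_combine fb) (auto simp: disjoint4_def)
  then have bijV: "bij_betw f (verts G) (verts H)"
    by (simp add: V)
  have mem: "f u \<in> S' \<longleftrightarrow> u \<in> S" if "u \<in> verts G" "S \<subseteq> verts G" "bij_betw f S S'" for u S S'
    using that bijV unfolding bij_betw_def by (metis inj_on_image_mem_iff)
  have memXYZ: "f u \<in> X' \<longleftrightarrow> u \<in> X" "f u \<in> Y' \<longleftrightarrow> u \<in> Y" "f u \<in> Z' \<longleftrightarrow> u \<in> Z" if "u \<in> verts G" for u
    using mem[OF that _ fb(2)] mem[OF that _ fb(3)] mem[OF that _ fb(4)] V by auto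
  show ?thesis
    by (rule digraph_isoI[OF assms(7,8) bijV])
      (simp add: E tripartite_arcs_def memXYZ)
qed

text \<open>A bare pair digraph may have arcs outside its vertex set; the tripartite description
  excludes this. Its arcs are pairs, so none are parallel.\<close>

lemma nomulti_digraph_isolated_plus_tripartite:
  assumes "isolated_plus_tripartite (with_proj H) I X Y Z"
  shows "nomulti_digraph (with_proj H)"
proof unfold_locales
  have "parcs H = tripartite_arcs X Y Z" "pverts H = I \<union> X \<union> Y \<union> Z"
    using assms by (simp_all add: isolated_plus_tripartite_def)
  then have sub: "parcs H \<subseteq> pverts H \<times> pverts H"
    by (simp add: tripartite_arcs_def) blast
  fix e assume "e \<in> arcs (with_proj H)"
  then have "e \<in> pverts H \<times> pverts H"
    using sub by auto
  then show "tail (with_proj H) e \<in> verts (with_proj H)" "head (with_proj H) e \<in> verts (with_proj H)"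
    by auto
qed (simp add: arc_to_ends_def prod_eq_iff)

lemma complete_bipartite_iff_tripartite:
  "K\<^bsub>m,n\<^esub> (with_proj H) \<longleftrightarrow>
     (\<exists>X Y. isolated_plus_tripartite (with_proj H) {} X Y {} \<and> card X = m \<and> card Y = n)"
proof -
  have "isolated_plus_tripartite (with_proj H) {} X Y {} \<longleftrightarrow>
      finite (pverts H) \<and> pverts H = X \<union> Y \<and> X \<inter> Y = {} \<and> parcs H = X \<times> Y \<union> Y \<times> X" for X Y
    by (auto simp: isolated_plus_tripartite_def disjoint4_def tripartite_arcs_def)
  then show ?thesis
    unfolding complete_bipartite_digraph_pair_def by metis
qed

text \<open>The opposite vertices of the 4-cycle form the two parts of size two, and the joined
  vertex is the third part.\<close>

lemma join_K1_C4_tripartite: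
  "isolated_plus_tripartite (with_proj (graph_join (complete_graph 1) (cycle_graph 4)))
     {} {Inr 0, Inr 2} {Inr 1, Inr 3} {Inl 0}"
proof -
  have four: "{..<4::nat} = {0, 1, 2, 3}" by auto
  have "parcs (cycle_graph 4) = {0, 2} \<times> {1, 3} \<union> {1, 3} \<times> {0, 2}"
  proof (intro equalityI subrelI)
    fix i j :: nat assume "(i, j) \<in> parcs (cycle_graph 4)"
    then have "i \<in> {..<4}" "j \<in> {..<4}" "j = Suc i mod 4 \<or> i = Suc j mod 4"
      by (auto simp: cycle_graph_def)
    then show "(i, j) \<in> {0, 2} \<times> {1, 3} \<union> {1, 3} \<times> {0, 2}"
      unfolding four by auto
  qed (auto simp: cycle_graph_def)
  moreover have "pverts (cycle_graph 4) = {0, 1, 2, 3}"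
    using four by (simp add: cycle_graph_def)
  moreover have "pverts (complete_graph 1) = {0}" "parcs (complete_graph 1) = {}"
    by (auto simp: complete_graph_def)
  ultimately show ?thesis
    unfolding isolated_plus_tripartite_def
    by (auto simp: graph_join_def disjoint_union_def disjoint4_def tripartite_arcs_def Plus_def)
qed

lemma disjoint_union_tripartite:
  assumes "isolated_plus_tripartite (with_proj H) {} X Y Z"
  shows "isolated_plus_tripartite
    (with_proj (disjoint_union (copies n (complete_graph 1)) H))
    (Inl ` ({..<n} \<times> {0})) (Inr ` X) (Inr ` Y) (Inr ` Z)"
proof -
  have "pverts (copies n (complete_graph 1)) = {..<n} \<times> {0}" "parcs (copies n (complete_graph 1)) = {}"
    by (auto simp: copies_def complete_graph_def)
  moreover have "map_prod Inr Inr ` tripartite_arcs X Y Z =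
      tripartite_arcs (Inr ` X) (Inr ` Y) (Inr ` Z)"
    by (simp add: tripartite_arcs_def image_Un map_prod_surj_on)
  ultimately show ?thesis
    using assms unfolding isolated_plus_tripartite_def
    by (auto simp: disjoint_union_def disjoint4_def Plus_def)
qed

text \<open>Consecutive intervals serve as parts, providing a witness over \<open>nat\<close> for
  any prescribed sizes.\<close>

lemma ex_nat_tripartite:
  obtains H :: "nat pair_pre_digraph" and X Y Z
  where "isolated_plus_tripartite (with_proj H) {} X Y Z" "card X = a" "card Y = b" "card Z = c"
proof -
  let ?X = "{..<a}" and ?Y = "{a..<a + b}" and ?Z = "{a + b..<a + b + c}"
  have "isolated_plus_tripartite
      (with_proj \<lparr> pverts = ?X \<union> ?Y \<union> ?Z, parcs = tripartite_arcs ?X ?Y ?Z \<rparr>) {} ?X ?Y ?Z"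
    by (auto simp: isolated_plus_tripartite_def disjoint4_def)
  then show thesis
    using that by fastforce
qed

text \<open>\<open>critical_sizes\<close> compares \<open>Z\<close> with \<open>{}\<close>, while
  \<open>card\<close> is 0 on infinite sets as well; hence the finiteness assumptions.\<close>

lemma critical_sizes_cong:
  assumes "finite Z" "finite Z'" "card X = card X'" "card Y = card Y'" "card Z = card Z'"
  shows "critical_sizes k X Y Z \<longleftrightarrow> critical_sizes k X' Y' Z'"
proof -
  have "Z = {} \<longleftrightarrow> Z' = {}"
    using assms card_0_eq by metis
  then show ?thesis
    using assms by (simp add: critical_sizes_def)
qed

text \<open>Trades the existence of \<open>H\<close> for a division of the vertices of
  \<open>G\<close>. One direction transports the division along the isomorphism, the other reads off
  the sizes and builds \<open>H\<close> on \<open>nat\<close>.\<close>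

lemma iso_critical_iff:
  fixes G :: "('a, 'b) pre_digraph"
  assumes "graph G"
  shows "(\<exists>H :: nat pair_pre_digraph.
       (K\<^bsub>k + 1,k + 1\<^esub> (with_proj H) \<or>
        digraph_iso (with_proj H)
          (with_proj (graph_join (complete_graph 1) (cycle_graph 4)))) \<and>
       digraph_iso G
         (with_proj (disjoint_union (copies (k + 1) (complete_graph 1)) H))) \<longleftrightarrow>
    (\<exists>I X Y Z. isolated_plus_tripartite G I X Y Z \<and> card I = k + 1 \<and> critical_sizes k X Y Z)"
    (is "?L \<longleftrightarrow> ?R")
proof
  interpret graph G by fact
  assume ?L
  then obtain H :: "nat pair_pre_digraph" where
    H: "K\<^bsub>k + 1,k + 1\<^esub> (with_proj H) \<or>
        digraph_iso (with_proj H) (with_proj (graph_join (complete_graph 1) (cycle_graph 4)))"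
    and GH: "digraph_iso G (with_proj (disjoint_union (copies (k + 1) (complete_graph 1)) H))"
    by blast
  have "\<exists>X Y Z. isolated_plus_tripartite (with_proj H) {} X Y Z \<and> critical_sizes k X Y Z"
    using H
  proof
    assume "K\<^bsub>k + 1,k + 1\<^esub> (with_proj H)"
    then show ?thesis
      unfolding complete_bipartite_iff_tripartite critical_sizes_def by blast
  next
    let ?J = "with_proj (graph_join (complete_graph 1) (cycle_graph 4))"
    assume HJ: "digraph_iso (with_proj H) ?J"
    \<comment> \<open>Well-formedness of the source is part of the notion of isomorphism, so
      \<open>H\<close> inherits it from \<open>HJ\<close>.\<close>
    then have wf: "wf_digraph (with_proj H)"
      by (auto simp: digraph_iso_def pre_digraph.digraph_isomorphism_def)
    with HJ have "digraph_iso ?J (with_proj H)"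
      by (rule digraph_iso_swap[rotated])
    then obtain I X Y Z where *: "isolated_plus_tripartite (with_proj H) I X Y Z"
      "card I = card ({} :: (nat + nat) set)" "card X = card {Inr 0, Inr 2 :: nat + nat}"
      "card Y = card {Inr 1, Inr 3 :: nat + nat}" "card Z = card {Inl 0 :: nat + nat}"
      using isolated_plus_tripartite_iso[OF join_K1_C4_tripartite _ wf] by blast
    then have "finite I"
      by (auto simp: isolated_plus_tripartite_def)
    then have "I = {}"
      using * by simp
    moreover have "critical_sizes k X Y Z"
      using * by (simp add: critical_sizes_def)
    ultimately show ?thesis
      using * by blast
  qed
  then obtain X Y Z where XYZ: "isolated_plus_tripartite (with_proj H) {} X Y Z" "critical_sizes k X Y Z"
    by blast
  from disjoint_union_tripartite[OF XYZ(1)] digraph_iso_swap[OF wf_digraph GH] wf_digraph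
  obtain I' X' Y' Z' where *: "isolated_plus_tripartite G I' X' Y' Z'"
    "card I' = card (Inl ` ({..<k + 1} \<times> {0 :: nat}) :: (nat \<times> nat + nat) set)"
    "card X' = card (Inr ` X :: (nat \<times> nat + nat) set)"
    "card Y' = card (Inr ` Y :: (nat \<times> nat + nat) set)"
    "card Z' = card (Inr ` Z :: (nat \<times> nat + nat) set)"
    by (rule isolated_plus_tripartite_iso)
  have "finite Z" "finite Z'"
    using XYZ(1) *(1) by (auto simp: isolated_plus_tripartite_def)
  then have "critical_sizes k X' Y' Z'"
    using critical_sizes_cong[of Z' Z X' X Y' Y k] XYZ(2) * by (simp add: card_image)
  then show ?R
    using * by (auto simp: card_image card_cartesian_product)
next
  interpret graph G by fact
  assume ?R
  then obtain I X Y Z where G: "isolated_plus_tripartite G I X Y Z" "card I = k + 1" "critical_sizes k X Y Z"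
    by blast
  obtain H :: "nat pair_pre_digraph" and X' Y' Z' where
    H: "isolated_plus_tripartite (with_proj H) {} X' Y' Z'" "card X' = card X" "card Y' = card Y" "card Z' = card Z"
    by (rule ex_nat_tripartite)
  have "finite Z" "finite Z'"
    using G(1) H(1) by (auto simp: isolated_plus_tripartite_def)
  then have c: "critical_sizes k X' Y' Z'"
    using critical_sizes_cong[of Z' Z X' X Y' Y k] G(3) H by blast
  have "K\<^bsub>k + 1,k + 1\<^esub> (with_proj H) \<or>
    digraph_iso (with_proj H) (with_proj (graph_join (complete_graph 1) (cycle_graph 4)))"
    using c unfolding critical_sizes_def
  proof (elim disjE conjE)
    assume "card X' = k + 1" "card Y' = k + 1" "Z' = {}"
    then show ?thesis
      using H(1) complete_bipartite_iff_tripartite by blast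
  next
    assume "card X' = 2" "card Y' = 2" "card Z' = 1"
    then have "digraph_iso (with_proj H) (with_proj (graph_join (complete_graph 1) (cycle_graph 4)))"
      using nomulti_digraph_isolated_plus_tripartite[OF H(1)]
        nomulti_digraph_isolated_plus_tripartite[OF join_K1_C4_tripartite]
      by (intro isolated_plus_tripartite_iso_if_card_eq[OF H(1) join_K1_C4_tripartite]) simp_all
    then show ?thesis by blast
  qed
  moreover have "digraph_iso G (with_proj (disjoint_union (copies (k + 1) (complete_graph 1)) H))"
    by (rule isolated_plus_tripartite_iso_if_card_eq[OF G(1) disjoint_union_tripartite[OF H(1)]])
      (use G H nomulti_digraph
        nomulti_digraph_isolated_plus_tripartite[OF disjoint_union_tripartite[OF H(1)]] in
        \<open>simp_all add: card_image card_cartesian_product\<close>)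
  ultimately show ?L by blast
qed

section \<open>Cograph property and component counts\<close>

text \<open>In an induced path on 0, 1, 2, 3 no vertex is isolated, so all lie in the tripartite
  part. There 0 and 3, and 3 and 1, are non-adjacent, whereas 0 and 1 are adjacent, against
  transitivity of non-adjacency.\<close>

lemma cograph_isolated_plus_tripartite:
  assumes "graph G" and G: "isolated_plus_tripartite G I X Y Z"
  shows "cograph G"
  unfolding cograph_def
proof (intro conjI notI)
  interpret graph G by fact
  assume "\<exists>H. induced_subgraph H G \<and> digraph_iso H (with_proj (path_graph 4))"
  then obtain H where H: "induced_subgraph H G" "digraph_iso H (with_proj (path_graph 4))" by blast
  have "wf_digraph H"
    using H(1) by (rule wf_digraphI_induced)
  then have "digraph_iso (with_proj (path_graph 4)) H"
    using H(2) by (rule digraph_iso_swap)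
  then obtain f where f: "bij_betw f (verts (with_proj (path_graph 4))) (verts H)"
    and adj: "\<And>u v. u \<in> verts (with_proj (path_graph 4)) \<Longrightarrow> v \<in> verts (with_proj (path_graph 4)) \<Longrightarrow>
      (u, v) \<in> arcs_ends (with_proj (path_graph 4)) \<longleftrightarrow> (f u, f v) \<in> arcs_ends H"
    by (rule digraph_isoE) blast
  have H': "H = G \<restriction> verts H"
    using induce_eq_iff_induced[OF H(1)] by simp
  have "(f u, f v) \<in> arcs_ends G \<longleftrightarrow> v = Suc u \<or> u = Suc v" if "u < 4" "v < 4" for u v
  proof -
    have "f u \<in> verts H" "f v \<in> verts H"
      using f that by (auto simp: bij_betw_def path_graph_def)
    moreover have "arcs_ends H = arcs_ends G \<inter> verts H \<times> verts H"
      using H' arcs_ends_induce_subgraph by metis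
    ultimately show ?thesis
      using adj[of u v] that by (simp add: path_graph_def)
  qed
  then have a: "(f 0, f 1) \<in> arcs_ends G" "(f 2, f 3) \<in> arcs_ends G"
    and n: "(f 0, f 3) \<notin> arcs_ends G" "(f 3, f 1) \<notin> arcs_ends G"
    by simp_all
  have "arcs_ends G = tripartite_arcs X Y Z" "disjoint4 I X Y Z"
    using G by (auto simp: isolated_plus_tripartite_def)
  then show False
    using a n nonadj_trans_tripartite[of I X Y Z] unfolding nonadj_trans_def tripartite_arcs_def by blast
qed (rule assms)

text \<open>Two nonempty parts make the tripartite graph one nontrivial component; every vertex of
  \<open>I\<close> is a trivial one.\<close>

lemma (in graph) has_type_isolated_plus_tripartite:
  assumes G: "isolated_plus_tripartite G I X Y Z" and ne: "X \<noteq> {}" "Y \<noteq> {}"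
  shows "has_type G (card I + 1) (card I)"
proof -
  have V: "verts G = I \<union> X \<union> Y \<union> Z" and E: "arcs_ends G = tripartite_arcs X Y Z"
    and dis: "disjoint4 I X Y Z" and fin: "finite (verts G)"
    using G by (auto simp: isolated_plus_tripartite_def)
  define W where "W = X \<union> Y \<union> Z"
  have iso: "(i, v) \<notin> arcs_ends G" if "i \<in> I" for i v
    using that dis by (auto simp: E tripartite_arcs_def disjoint4_def)
  have nbr: "\<exists>v. (w, v) \<in> arcs_ends G" if "w \<in> W" for w
    using that ne by (auto simp: E tripartite_arcs_def W_def)
  have "{u \<in> verts G. \<forall>v. (u, v) \<notin> arcs_ends G} = I"
    using iso nbr V unfolding W_def by blast
  then have triv: "card (trivial_components G) = card I"
    by (simp add: card_trivial_components)
  let ?c = "\<lambda>u. {v. u \<rightarrow>\<^sup>* v}"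
  have cI: "?c i = {i}" if "i \<in> I" for i
    using that iso V by (intro reachable_isolated) auto
  have cW: "?c w = W" if w: "w \<in> W" for w
  proof (intro equalityI subsetI)
    fix v assume "v \<in> ?c w"
    then have "w \<rightarrow>\<^sup>* v" by simp
    then show "v \<in> W"
      using w by (induct rule: reachable_induct) (auto simp: E tripartite_arcs_def W_def)
  next
    fix v assume v: "v \<in> W"
    obtain x y where xy: "x \<in> X" "y \<in> Y" using ne by blast
    \<comment> \<open>A vertex of \<open>X\<close> reaches \<open>x\<close> through
      \<open>y\<close>; every other vertex of \<open>W\<close> is adjacent to
      \<open>x\<close>.\<close>
    have "w \<rightarrow>\<^sup>* x" if "w \<in> W" for w
    proof (cases "w \<in> X")
      case True
      then have "w \<rightarrow> y" "y \<rightarrow> x"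
        using xy by (auto simp: E tripartite_arcs_def)
      then show ?thesis
        by (meson reachable_adjI reachable_trans)
    next
      case False
      then have "w \<rightarrow> x"
        using xy that by (auto simp: E tripartite_arcs_def W_def)
      then show ?thesis by blast
    qed
    then show "v \<in> ?c w"
      using v w symmetric_reachable' reachable_trans by blast
  qed
  have "?c ` verts G = (\<lambda>i. {i}) ` I \<union> {W}"
  proof -
    have "?c ` I = (\<lambda>i. {i}) ` I"
      using cI by (rule image_cong[OF refl])
    moreover have "?c ` W = {W}"
      using cW ne by (auto simp: W_def)
    moreover have "verts G = I \<union> W"
      using V by (auto simp: W_def)
    ultimately show ?thesis
      by (simp only: image_Un)
  qed
  moreover have "W \<notin> (\<lambda>i. {i}) ` I"
    using dis ne by (auto simp: W_def disjoint4_def)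
  moreover have "finite I"
    using fin V by auto
  ultimately have "card (components G) = card I + 1"
    by (simp add: card_components card_image)
  then show ?thesis
    using triv by (simp add: has_type_def)
qed

theorem theorem8:
  fixes G :: "('a, 'b) pre_digraph" and k :: nat
  assumes "graph G" and "k \<ge> 2"
  shows "cograph_minimal_polar_obstruction \<infinity> (enat k) G \<and> has_type G (k + 2) (k + 1) \<longleftrightarrow>
    (\<exists>H :: nat pair_pre_digraph.
       (K\<^bsub>k + 1,k + 1\<^esub> (with_proj H) \<or>
        digraph_iso (with_proj H)
          (with_proj (graph_join (complete_graph 1) (cycle_graph 4)))) \<and>
       digraph_iso G
         (with_proj (disjoint_union (copies (k + 1) (complete_graph 1)) H)))"
  unfolding iso_critical_iff[OF assms(1)]
proof
  interpret graph G by fact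
  assume *: "cograph_minimal_polar_obstruction \<infinity> (enat k) G \<and> has_type G (k + 2) (k + 1)"
  define I where "I = {u \<in> verts G. \<forall>v. (u, v) \<notin> arcs_ends G}"
  from * have non: "\<not> polar_set k (arcs_ends G) (verts G)"
    and min: "\<And>X. X \<subset> verts G \<Longrightarrow> polar_set k (arcs_ends G) X"
    by (simp_all add: minimal_obstruction_iff)
  have "\<exists>X Y Z. disjoint4 I X Y Z \<and> verts G = I \<union> X \<union> Y \<union> Z \<and>
      arcs_ends G = tripartite_arcs X Y Z \<and> critical_sizes k X Y Z"
  proof (rule critical_structure)
    show "card I = k + 1"
      using * by (simp add: I_def has_type_def card_trivial_components)
    show "sym (arcs_ends G)"
      using sym_arcs by (simp add: symmetric_def)
    show "irrefl (arcs_ends G)"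
      using irrefl_arcs_ends by (simp add: irrefl_def)
    show "arcs_ends G \<subseteq> verts G \<times> verts G"
      using adj_in_verts by auto
    show "I \<subseteq> verts G" "\<And>i v. i \<in> I \<Longrightarrow> (i, v) \<notin> arcs_ends G"
      by (auto simp: I_def)
  qed (rule finite_verts non min assms(2); assumption)+
  moreover have "card I = k + 1"
    using * by (simp add: I_def has_type_def card_trivial_components)
  ultimately show "\<exists>I X Y Z. isolated_plus_tripartite G I X Y Z \<and> card I = k + 1 \<and> critical_sizes k X Y Z"
    unfolding isolated_plus_tripartite_def using finite_verts by metis
next
  interpret graph G by fact
  assume "\<exists>I X Y Z. isolated_plus_tripartite G I X Y Z \<and> card I = k + 1 \<and> critical_sizes k X Y Z"
  then obtain I X Y Z where G: "isolated_plus_tripartite G I X Y Z" and I: "card I = k + 1"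
    and c: "critical_sizes k X Y Z"
    by blast
  have V: "verts G = I \<union> X \<union> Y \<union> Z" and E: "arcs_ends G = tripartite_arcs X Y Z"
    and dis: "disjoint4 I X Y Z" and fin: "finite (I \<union> X \<union> Y \<union> Z)"
    using G by (auto simp: isolated_plus_tripartite_def)
  have "X \<noteq> {}" "Y \<noteq> {}"
    using c by (auto simp: critical_sizes_def)
  then have "has_type G (k + 2) (k + 1)"
    using has_type_isolated_plus_tripartite[OF G] I by simp
  moreover have "\<not> polar_set k (arcs_ends G) (verts G)"
  proof (rule not_polar_set_critical[OF dis _ I c])
    show "arcs_ends G \<inter> (I \<union> X \<union> Y \<union> Z) \<times> (I \<union> X \<union> Y \<union> Z) = tripartite_arcs X Y Z"
      unfolding E by (auto simp: tripartite_arcs_def)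
  qed (auto simp: V)
  moreover have "polar_set k (arcs_ends G) S" if "S \<subset> verts G" for S
  proof -
    \<comment> \<open>A proper subset misses some vertex \<open>v\<close>, so it suffices to treat
      the deletion of \<open>v\<close> and then use monotonicity.\<close>
    from that obtain v where v: "v \<in> verts G" "S \<subseteq> verts G - {v}" by blast
    have "polar_set k (arcs_ends G) (verts G - {v})"
      using polar_set_delete_vertex[OF dis fin I c assms(2)] v(1) unfolding V E by blast
    then show ?thesis
      using v(2) by (rule polar_set_mono)
  qed
  ultimately show "cograph_minimal_polar_obstruction \<infinity> (enat k) G \<and> has_type G (k + 2) (k + 1)"
    using cograph_isolated_plus_tripartite[OF assms(1) G] by (simp add: minimal_obstruction_iff)
qed

end
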